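(* Let $p\ge2$ be an integer. Each element $g\in F(p)$ can be uniquely represented as a word of the form $$N(g)=x_{i_1}^{\varepsilon_1}x_{i_2}^{\varepsilon_2}\cdots x_{i_m}^{\varepsilon_m},$$ where $m\ge0$, $i_1,\dots,i_m\ge 0$ are integers, $\varepsilon_1,\varepsilon_2,\ldots,\varepsilon_m\in\{1,-1\}$, and for every $1\le k<m$ one of the following conditions holds: \begin{itemize} \item $i_k<i_{k+1}$; \item $i_k=i_{k+1}$ and $\varepsilon_k=\varepsilon_{k+1}$; \item $0<i_k-i_{k+1}<p$ and $\varepsilon_{k+1}=-1$. \end{itemize}
   Context: For an integer $p\ge2$, the generalized Thompson group $F(p)$ is the group given by the presentation $\langle x_i\ (i\ge0)\mid x_jx_i=x_ix_{j+p-1}\ (0\le i<j)\rangle$. Words are over the infinite alphabet $\{x_i^{\pm1}: i\ge0\}$. *)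

theory Defs
  imports "HOL-Algebra.Group"
begin

text \<open>Words over the alphabet of letters \<open>a\<close> and \<open>a\<inverse>\<close>: the letter \<open>(a, True)\<close> stands for
  \<open>a\<close> and \<open>(a, False)\<close> for \<open>a\<inverse>\<close>.  Words are not assumed to be freely reduced.\<close>

type_synonym 'a word = "('a \<times> bool) list"

text \<open>Equality of words in the group presented by the relations \<open>u = v\<close> with \<open>(u, v) \<in> R\<close>:
  the least congruence on words that contains \<open>R\<close> and all cancellations
  \<open>a a\<inverse> = 1 = a\<inverse> a\<close>.\<close>

inductive pres_eq :: "('a word \<times> 'a word) set \<Rightarrow> 'a word \<Rightarrow> 'a word \<Rightarrow> bool"
  for R :: "('a word \<times> 'a word) set" where
  relation: "(u, v) \<in> R \<Longrightarrow> pres_eq R u v"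
| cancel: "pres_eq R [(a, e), (a, \<not> e)] []"
| refl: "pres_eq R u u"
| sym: "pres_eq R u v \<Longrightarrow> pres_eq R v u"
| trans: "pres_eq R u v \<Longrightarrow> pres_eq R v w \<Longrightarrow> pres_eq R u w"
| append: "pres_eq R u u' \<Longrightarrow> pres_eq R v v' \<Longrightarrow> pres_eq R (u @ v) (u' @ v')"

definition word_class :: "('a word \<times> 'a word) set \<Rightarrow> 'a word \<Rightarrow> 'a word set" where
  "word_class R u = {v. pres_eq R u v}"

definition pres_group :: "('a word \<times> 'a word) set \<Rightarrow> 'a word set monoid" where
  "pres_group R =
     \<lparr> carrier = range (word_class R),
       mult = (\<lambda>A B. \<Union>u\<in>A. \<Union>v\<in>B. word_class R (u @ v)),
       one = word_class R [] \<rparr>"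

definition thompson_rels :: "nat \<Rightarrow> (nat word \<times> nat word) set" where
  "thompson_rels p =
     {([(j, True), (i, True)], [(i, True), (j + p - 1, True)]) | i j. i < j}"

definition thompson_F :: "nat \<Rightarrow> nat word set monoid" where
  "thompson_F p = pres_group (thompson_rels p)"

definition thompson_gen :: "nat \<Rightarrow> nat \<Rightarrow> nat word set" where
  "thompson_gen p i = word_class (thompson_rels p) [(i, True)]"

text \<open>The element of \<open>F(p)\<close> represented by a word, i.e. the product of its letters in \<open>F(p)\<close>.\<close>

definition word_value :: "nat \<Rightarrow> nat word \<Rightarrow> nat word set" where
  "word_value p w =
     foldr (\<lambda>(i, e) g. (if e then thompson_gen p i else inv\<^bsub>thompson_F p\<^esub> thompson_gen p i)
                         \<otimes>\<^bsub>thompson_F p\<^esub> g)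
       w \<one>\<^bsub>thompson_F p\<^esub>"

definition normal_word :: "nat \<Rightarrow> nat word \<Rightarrow> bool" where
  "normal_word p w \<longleftrightarrow>
     (\<forall>k. Suc k < length w \<longrightarrow>
        (let (i, e) = w ! k; (i', e') = w ! Suc k in
           i < i' \<or>
           (i = i' \<and> e = e') \<or>
           (0 < int i - int i' \<and> int i - int i' < int p \<and> e' = False)))"

lemma word_class_eq_iff: "word_class R u = word_class R v \<longleftrightarrow> pres_eq R u v"
proof
  assume "word_class R u = word_class R v"
  moreover have "v \<in> word_class R v" by (simp add: word_class_def pres_eq.refl)
  ultimately have "v \<in> word_class R u" by simp
  then show "pres_eq R u v" by (simp add: word_class_def)
next
  assume uv: "pres_eq R u v"
  have "pres_eq R u w \<longleftrightarrow> pres_eq R v w" for w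
    using pres_eq.trans[OF uv] pres_eq.trans[OF pres_eq.sym[OF uv]] by blast
  then show "word_class R u = word_class R v" by (simp add: word_class_def)
qed

lemma mult_word_class:
  "word_class R u \<otimes>\<^bsub>pres_group R\<^esub> word_class R v = word_class R (u @ v)"
proof -
  have eq: "word_class R (u' @ v') = word_class R (u @ v)"
    if "u' \<in> word_class R u" "v' \<in> word_class R v" for u' v'
  proof -
    have "pres_eq R (u @ v) (u' @ v')"
      using that by (intro pres_eq.append) (simp_all add: word_class_def)
    then show ?thesis
      unfolding word_class_eq_iff by (rule pres_eq.sym)
  qed
  have "u \<in> word_class R u" "v \<in> word_class R v"
    by (simp_all add: word_class_def pres_eq.refl)
  then have "(\<Union>u'\<in>word_class R u. \<Union>v'\<in>word_class R v. word_class R (u' @ v')) = word_class R (u @ v)"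
    using eq by blast
  then show ?thesis
    by (simp add: pres_group_def)
qed

lemma one_pres_group: "\<one>\<^bsub>pres_group R\<^esub> = word_class R []"
  by (simp add: pres_group_def)

lemma word_class_in_carrier: "word_class R u \<in> carrier (pres_group R)"
  by (simp add: pres_group_def)

lemma word_class_left_inverse:
  "\<exists>v. word_class R (v @ u) = word_class R []"
proof (induction u)
  case Nil
  show ?case by (rule exI[of _ "[]"]) simp
next
  case (Cons x u)
  obtain a e where x: "x = (a, e)" by force
  from Cons obtain v where v: "pres_eq R (v @ u) []"
    by (auto simp: word_class_eq_iff)
  have "pres_eq R [(a, \<not> e), (a, e)] []"
    using pres_eq.cancel[of R a "\<not> e"] by simp
  from pres_eq.append[OF pres_eq.refl[of R v] pres_eq.append[OF this pres_eq.refl[of R u]]]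
  have "pres_eq R ((v @ [(a, \<not> e)]) @ x # u) (v @ u)"
    by (simp add: x)
  then have "pres_eq R ((v @ [(a, \<not> e)]) @ x # u) []"
    using v by (rule pres_eq.trans)
  then show ?case unfolding word_class_eq_iff by blast
qed

lemma group_pres_group: "group (pres_group R)"
proof (rule groupI)
  fix x assume "x \<in> carrier (pres_group R)"
  then obtain u where u: "x = word_class R u" by (auto simp: pres_group_def)
  obtain v where "word_class R (v @ u) = word_class R []"
    using word_class_left_inverse by blast
  then show "\<exists>y\<in>carrier (pres_group R). y \<otimes>\<^bsub>pres_group R\<^esub> x = \<one>\<^bsub>pres_group R\<^esub>"
    using u by (metis mult_word_class one_pres_group word_class_in_carrier)
next
  fix x y assume "x \<in> carrier (pres_group R)" "y \<in> carrier (pres_group R)"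
  then obtain u v where "x = word_class R u" "y = word_class R v"
    by (auto simp: pres_group_def)
  then show "x \<otimes>\<^bsub>pres_group R\<^esub> y \<in> carrier (pres_group R)"
    by (simp add: mult_word_class word_class_in_carrier)
next
  fix x y z
  assume "x \<in> carrier (pres_group R)" "y \<in> carrier (pres_group R)" "z \<in> carrier (pres_group R)"
  then obtain u v w where "x = word_class R u" "y = word_class R v" "z = word_class R w"
    by (auto simp: pres_group_def)
  then show "x \<otimes>\<^bsub>pres_group R\<^esub> y \<otimes>\<^bsub>pres_group R\<^esub> z = x \<otimes>\<^bsub>pres_group R\<^esub> (y \<otimes>\<^bsub>pres_group R\<^esub> z)"
    by (simp add: mult_word_class)
next
  fix x assume "x \<in> carrier (pres_group R)"
  then obtain u where "x = word_class R u" by (auto simp: pres_group_def)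
  then show "\<one>\<^bsub>pres_group R\<^esub> \<otimes>\<^bsub>pres_group R\<^esub> x = x"
    by (simp add: mult_word_class one_pres_group)
qed (simp add: one_pres_group word_class_in_carrier)

lemma inv_word_class_letter:
  "inv\<^bsub>pres_group R\<^esub> word_class R [(a, e)] = word_class R [(a, \<not> e)]"
proof -
  have "word_class R [(a, \<not> e), (a, e)] = word_class R []"
    using pres_eq.cancel[of R a "\<not> e"] by (simp add: word_class_eq_iff)
  then have "word_class R [(a, \<not> e)] \<otimes>\<^bsub>pres_group R\<^esub> word_class R [(a, e)] = \<one>\<^bsub>pres_group R\<^esub>"
    by (simp add: mult_word_class one_pres_group)
  then show ?thesis
    by (intro group.inv_equality[OF group_pres_group] word_class_in_carrier)
qed

lemma group_thompson_F: "group (thompson_F p)"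
  by (simp add: thompson_F_def group_pres_group)

lemma word_value_eq_word_class: "word_value p w = word_class (thompson_rels p) w"
proof (induction w)
  case Nil
  show ?case by (simp add: word_value_def thompson_F_def one_pres_group)
next
  case (Cons x w)
  obtain i e where x: "x = (i, e)" by force
  show ?case
    using Cons
    by (cases e)
      (simp_all add: x word_value_def thompson_F_def thompson_gen_def
        inv_word_class_letter mult_word_class)
qed

end

theory Submission imports Defs begin

text \<open>The proof is van der Waerden's trick: the letters act on the set of normal words by left
  multiplication followed by normalization.  This action respects the defining relations, hence it
  factors through equality in \<open>F(p)\<close>, and a normal word \<open>w\<close> is recovered from its class as the
  image of the empty word under \<open>w\<close>.  No termination argument is needed.\<close>

fun admissible :: "nat \<Rightarrow> nat \<times> bool \<Rightarrow> nat \<times> bool \<Rightarrow> bool" where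
  "admissible p (i, e) (k, f) \<longleftrightarrow> i < k \<or> i = k \<and> e = f \<or> k < i \<and> i < k + p \<and> \<not> f"

text \<open>Moving \<open>x\<^sub>i\<^sup>\<plusminus>\<^sup>1\<close> to the right past \<open>x\<^sub>k\<close> (\<open>f = True\<close>) or \<open>x\<^sub>k\<inverse>\<close> (\<open>f = False\<close>) turns \<open>i\<close> into
  \<open>shift p f i\<close>.  The subtraction is only used for \<open>i \<ge> k + p\<close>, where it does not truncate.\<close>

definition shift :: "nat \<Rightarrow> bool \<Rightarrow> nat \<Rightarrow> nat" where
  "shift p f i = (if f then i + p - 1 else i + 1 - p)"

text \<open>For an inadmissible pair, \<open>i = k\<close> forces opposite signs, so the letters
  cancel; \<open>i \<noteq> k\<close> forces \<open>k < i\<close> and, for negative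
  \<open>f\<close>, also \<open>k + p \<le> i\<close>, which is when the new letter can pass
  \<open>(k, f)\<close>.\<close>

fun insert_letter :: "nat \<Rightarrow> nat \<times> bool \<Rightarrow> nat word \<Rightarrow> nat word" where
  "insert_letter p a [] = [a]"
| "insert_letter p (i, e) ((k, f) # w) =
     (if admissible p (i, e) (k, f) then (i, e) # (k, f) # w
      else if i = k then w
      else (k, f) # insert_letter p (shift p f i, e) w)"

abbreviation normalize :: "nat \<Rightarrow> nat word \<Rightarrow> nat word" where
  "normalize p u \<equiv> foldr (insert_letter p) u []"

lemma normal_word_iff: "normal_word p w \<longleftrightarrow> successively (admissible p) w"
proof -
  have "(let (i, e) = a; (i', e') = b in
           i < i' \<or> (i = i' \<and> e = e') \<or>
           (0 < int i - int i' \<and> int i - int i' < int p \<and> e' = False)) = admissible p a b"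
    for a b :: "nat \<times> bool"
    by (cases a; cases b) auto
  then show ?thesis
    by (simp add: normal_word_def successively_conv_nth)
qed

section \<open>Insertion preserves normality\<close>

lemma normal_word_Nil [simp]: "normal_word p []"
  by (simp add: normal_word_iff)

lemma normal_word_Cons:
  "normal_word p (a # w) \<longleftrightarrow> normal_word p w \<and> (w = [] \<or> admissible p a (hd w))"
  by (auto simp: normal_word_iff successively_Cons)

lemma insert_letter_normal:
  "normal_word p (a # w) \<Longrightarrow> insert_letter p a w = a # w"
  by (cases "(p, a, w)" rule: insert_letter.cases) (auto simp: normal_word_Cons)

text \<open>The bounds on \<open>i\<close> are the ones that \<open>shift p f\<close> produces when
  a letter passes \<open>(k, f)\<close>, and they persist along the recursion.\<close>

lemma normal_word_Cons_insert:
  assumes "normal_word p ((k, f) # w)" "p \<ge> 2" "k < i" "f \<Longrightarrow> k + p \<le> i"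
  shows "normal_word p ((k, f) # insert_letter p (i, e) w)"
  using assms
proof (induction w arbitrary: k f i)
  case Nil
  then show ?case by (simp add: normal_word_Cons)
next
  case (Cons b w)
  obtain l g where b: "b = (l, g)" by force
  consider "admissible p (i, e) (l, g)" | "i = l" "g = (\<not> e)"
    | "\<not> admissible p (i, e) (l, g)" "i \<noteq> l"
    by auto
  then show ?case
  proof cases
    case 1
    then show ?thesis using Cons.prems by (auto simp: b normal_word_Cons)
  next
    \<comment> \<open>Cancelling makes \<open>(k, f)\<close> adjacent to the letter
      \<open>(m, h)\<close> after \<open>(l, g)\<close>. The critical case is \<open>m < l\<close>,
      where \<open>h\<close> is false and \<open>l < m + p\<close>: for positive \<open>f\<close>,
      \<open>k + p \<le> l\<close> gives \<open>k < m\<close>; for negative \<open>f\<close>,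
      \<open>k < m + p\<close> suffices.\<close>
    case 2
    then show ?thesis
      using Cons.prems by (cases w) (force simp: b normal_word_Cons)+
  next
    case 3
    then have "normal_word p ((l, g) # insert_letter p (shift p g i, e) w)"
      using Cons.prems by (intro Cons.IH) (auto simp: b normal_word_Cons shift_def)
    then show ?thesis
      using 3 Cons.prems by (auto simp: b normal_word_Cons)
  qed
qed

lemma normal_word_insert:
  assumes "normal_word p w" "p \<ge> 2"
  shows "normal_word p (insert_letter p a w)"
proof (cases w)
  case Nil
  then show ?thesis by (simp add: normal_word_Cons)
next
  case (Cons b w')
  obtain i e k f where ab: "a = (i, e)" "b = (k, f)" by force
  have "normal_word p ((k, f) # insert_letter p (shift p f i, e) w')"
    if "\<not> admissible p (i, e) (k, f)" "i \<noteq> k"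
    using that assms by (intro normal_word_Cons_insert) (auto simp: ab Cons shift_def)
  then show ?thesis
    using assms by (simp add: ab Cons normal_word_Cons)
qed

lemma normal_word_foldr_insert:
  "normal_word p w \<Longrightarrow> p \<ge> 2 \<Longrightarrow> normal_word p (foldr (insert_letter p) u w)"
  by (induction u) (simp_all add: normal_word_insert)

section \<open>The action respects the defining relations\<close>

lemma insert_letter_cancel:
  assumes "normal_word p w"
  shows "insert_letter p (i, e) (insert_letter p (i, \<not> e) w) = w"
  using assms
proof (induction w arbitrary: i)
  case Nil
  then show ?case by simp
next
  case (Cons b w)
  obtain k f where b: "b = (k, f)" by force
  have IH: "insert_letter p (shift p f i, e) (insert_letter p (shift p f i, \<not> e) w) = w"
    using Cons by (simp add: normal_word_Cons)
  show ?case
  proof (cases "i = k \<and> f = e")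
    \<comment> \<open>The inner insertion cancels \<open>b\<close>; by normality the outer one puts
      it back in front.\<close>
    case True
    then show ?thesis using Cons.prems by (simp add: b insert_letter_normal)
  next
    \<comment> \<open>For \<open>i \<noteq> k\<close> admissibility ignores the sign of the left
      letter: either both insertions pass \<open>b\<close>, or the outer one cancels the letter just
      placed in front.\<close>
    case False
    then show ?thesis using IH by (auto simp: b)
  qed
qed

lemma insert_letter_commute:
  assumes "normal_word p w" "p \<ge> 2" "i < j"
  shows "insert_letter p (j, True) (insert_letter p (i, True) w) =
         insert_letter p (i, True) (insert_letter p (j + p - 1, True) w)"
  using assms
proof (induction w arbitrary: i j)
  case Nil
  then have "\<not> j + p - 1 \<le> i" by linarith
  with Nil show ?case by (auto simp: shift_def)
next
  case (Cons b w)
  obtain k f where b: "b = (k, f)" by force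
  consider "admissible p (i, True) (k, f)" | "i = k" "\<not> f"
    | "\<not> admissible p (i, True) (k, f)" "i \<noteq> k"
    by auto
  then show ?case
  proof cases
    \<comment> \<open>On the right, \<open>x_i\<close> still stays in front after the insertion of
      \<open>x_(j+p-1)\<close>, since \<open>i + p \<le> j + p - 1\<close>.\<close>
    case 1
    then have "normal_word p ((i, True) # b # w)"
      using Cons.prems by (simp add: b normal_word_Cons)
    then have "normal_word p ((i, True) # insert_letter p (j + p - 1, True) (b # w))"
      using Cons.prems by (intro normal_word_Cons_insert) auto
    from insert_letter_normal[OF this] show ?thesis
      using 1 Cons.prems by (simp add: b shift_def)
  next
    \<comment> \<open>\<open>x_i\<close> cancels \<open>b\<close> on both sides; on the right,
      \<open>x_(j+p-1)\<close> first passes \<open>b\<close> and becomes \<open>x_j\<close>.\<close>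
    case 2
    then have "i + p \<le> j + p - 1" using Cons.prems by linarith
    moreover have "j + p - 1 + 1 - p = j" using Cons.prems by linarith
    ultimately show ?thesis using 2 Cons.prems(2) by (simp add: b shift_def)
  next
    \<comment> \<open>All the letters pass \<open>b\<close>, and shifting preserves the relation
      between their indices.\<close>
    case 3
    have "shift p f (j + p - 1) = shift p f j + p - 1" "shift p f i < shift p f j"
      using 3 Cons.prems by (auto simp: shift_def)
    moreover have "normal_word p w"
      using Cons.prems by (simp add: normal_word_Cons)
    ultimately have "insert_letter p (shift p f j, True) (insert_letter p (shift p f i, True) w) =
        insert_letter p (shift p f i, True) (insert_letter p (shift p f (j + p - 1), True) w)"
      using Cons.IH Cons.prems(2) by simp
    moreover have "\<not> admissible p (j, True) (k, f)" "j \<noteq> k"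
        "\<not> admissible p (j + p - 1, True) (k, f)" "j + p - 1 \<noteq> k"
      using 3 Cons.prems by auto
    ultimately show ?thesis
      using 3 by (simp add: b del: admissible.simps)
  qed
qed

text \<open>In a product the right factor acts first, so \<open>w\<close> must vary in the
  induction, and \<open>normal_word_foldr_insert\<close> keeps the intermediate words
  normal.\<close>

lemma foldr_insert_cong:
  assumes "pres_eq (thompson_rels p) u v" "normal_word p w" "p \<ge> 2"
  shows "foldr (insert_letter p) u w = foldr (insert_letter p) v w"
  using assms
proof (induction arbitrary: w)
  case (relation u v)
  then show ?case
    by (auto simp: thompson_rels_def insert_letter_commute)
qed (simp_all add: insert_letter_cancel normal_word_foldr_insert)

lemma normalize_normal: "normal_word p w \<Longrightarrow> normalize p w = w"
  by (induction w) (simp_all add: normal_word_Cons insert_letter_normal)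

section \<open>Normalization stays in the class of the word\<close>

lemma pres_eq_Cons: "pres_eq R u v \<Longrightarrow> pres_eq R (a # u) (a # v)"
  using pres_eq.append[OF pres_eq.refl[of R "[a]"]] by simp

lemma pres_eq_append_right: "pres_eq R u v \<Longrightarrow> pres_eq R (u @ w) (v @ w)"
  by (intro pres_eq.append pres_eq.refl)

lemma pres_eq_conjugate:
  assumes "pres_eq R [a, (k, f)] [(k, f), b]"
  shows "pres_eq R [b, (k, \<not> f)] [(k, \<not> f), a]"
proof -
  have left: "pres_eq R [(k, \<not> f), (k, f), b, (k, \<not> f)] [b, (k, \<not> f)]"
    using pres_eq_append_right[OF pres_eq.cancel[of R k "\<not> f"], of "[b, (k, \<not> f)]"] by simp
  have right: "pres_eq R [(k, \<not> f), a, (k, f), (k, \<not> f)] [(k, \<not> f), a]"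
    using pres_eq.append[OF pres_eq.refl[of R "[(k, \<not> f), a]"] pres_eq.cancel[of R k f]] by simp
  have "pres_eq R [(k, \<not> f), a, (k, f), (k, \<not> f)] [(k, \<not> f), (k, f), b, (k, \<not> f)]"
    using pres_eq_Cons[OF pres_eq_append_right[OF assms, of "[(k, \<not> f)]"], of "(k, \<not> f)"] by simp
  then show ?thesis
    using left right by (meson pres_eq.sym pres_eq.trans)
qed

lemma pres_eq_invert:
  assumes "pres_eq R [(j, e), c] [c, (l, e)]"
  shows "pres_eq R [(j, \<not> e), c] [c, (l, \<not> e)]"
proof -
  obtain k f where c: "c = (k, f)" by force
  have left: "pres_eq R [(j, \<not> e), (j, e), c, (l, \<not> e)] [c, (l, \<not> e)]"
    using pres_eq_append_right[OF pres_eq.cancel[of R j "\<not> e"], of "[c, (l, \<not> e)]"] by simp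
  have right: "pres_eq R [(j, \<not> e), c, (l, e), (l, \<not> e)] [(j, \<not> e), c]"
    using pres_eq.append[OF pres_eq.refl[of R "[(j, \<not> e), c]"] pres_eq.cancel[of R l e]] by simp
  have "pres_eq R [(j, \<not> e), (j, e), c, (l, \<not> e)] [(j, \<not> e), c, (l, e), (l, \<not> e)]"
    using pres_eq_Cons[OF pres_eq_append_right[OF assms, of "[(l, \<not> e)]"], of "(j, \<not> e)"] by simp
  then show ?thesis
    using left right by (meson pres_eq.sym pres_eq.trans)
qed

text \<open>All sign patterns reduce to the defining relation: \<open>pres_eq_conjugate\<close>
  handles negative \<open>f\<close>, \<open>pres_eq_invert\<close> negative
  \<open>e\<close>.\<close>

lemma pres_eq_shift:
  assumes "\<not> admissible p (i, e) (k, f)" "i \<noteq> k"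
  shows "pres_eq (thompson_rels p) [(i, e), (k, f)] [(k, f), (shift p f i, e)]"
proof -
  have rel: "pres_eq (thompson_rels p) [(j, True), (k, True)] [(k, True), (j + p - 1, True)]"
    if "k < j" for j
    using that by (intro pres_eq.relation) (auto simp: thompson_rels_def)
  have "pres_eq (thompson_rels p) [(i, True), (k, f)] [(k, f), (shift p f i, True)]"
  proof (cases f)
    case True
    then show ?thesis using assms rel[of i] by (auto simp: shift_def)
  next
    case False
    \<comment> \<open>The relation is used backwards, at the index \<open>i + 1 - p\<close> that it
      raises to \<open>i\<close>; it exceeds \<open>k\<close> because
      \<open>k + p \<le> i\<close>.\<close>
    then have "k < i + 1 - p" "i + 1 - p + p - 1 = i"
      using assms by auto
    with pres_eq_conjugate[OF rel[of "i + 1 - p"]] False show ?thesis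
      by (simp add: shift_def)
  qed
  then show ?thesis
    using pres_eq_invert[of _ i True] by (cases e) auto
qed

lemma pres_eq_insert_letter: "pres_eq (thompson_rels p) (insert_letter p a w) (a # w)"
proof (induction p a w rule: insert_letter.induct)
  case (1 p a)
  show ?case by (simp add: pres_eq.refl)
next
  case (2 p i e k f w)
  consider "admissible p (i, e) (k, f)" | "i = k" "f = (\<not> e)"
    | "\<not> admissible p (i, e) (k, f)" "i \<noteq> k"
    by auto
  then show ?case
  proof cases
    case 1
    then show ?thesis by (simp add: pres_eq.refl)
  next
    case 2
    then show ?thesis
      using pres_eq.sym[OF pres_eq_append_right[OF pres_eq.cancel[of _ i e], of _ w]] by simp
  next
    case 3
    have "pres_eq (thompson_rels p) ((k, f) # insert_letter p (shift p f i, e) w)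
        ((k, f) # (shift p f i, e) # w)"
      using 2 3 by (intro pres_eq_Cons) auto
    moreover have "pres_eq (thompson_rels p) ((k, f) # (shift p f i, e) # w) ((i, e) # (k, f) # w)"
      using pres_eq.sym[OF pres_eq_append_right[OF pres_eq_shift[OF 3], of w]] by simp
    ultimately show ?thesis
      using 3 by (auto intro: pres_eq.trans)
  qed
qed

lemma pres_eq_normalize: "pres_eq (thompson_rels p) (normalize p u) u"
proof (induction u)
  case Nil
  show ?case by (simp add: pres_eq.refl)
next
  case (Cons a u)
  from pres_eq.trans[OF pres_eq_insert_letter pres_eq_Cons[OF this]] show ?case by simp
qed

theorem theorem5p1:
  fixes p :: nat and g :: "nat word set"
  assumes "p \<ge> 2" and "g \<in> carrier (thompson_F p)"
  shows "\<exists>!w. normal_word p w \<and> word_value p w = g"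
proof -
  obtain u where u: "g = word_class (thompson_rels p) u"
    using assms(2) by (auto simp: thompson_F_def pres_group_def)
  show ?thesis
  proof (rule ex1I[of _ "normalize p u"])
    show "normal_word p (normalize p u) \<and> word_value p (normalize p u) = g"
      using assms(1)
      by (simp add: u normal_word_foldr_insert word_value_eq_word_class word_class_eq_iff
          pres_eq_normalize)
  next
    fix w assume w: "normal_word p w \<and> word_value p w = g"
    then have "pres_eq (thompson_rels p) w u"
      by (simp add: u word_value_eq_word_class word_class_eq_iff)
    from foldr_insert_cong[OF this normal_word_Nil assms(1)] show "w = normalize p u"
      using w by (simp add: normalize_normal)
  qed
qed

end
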